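(* Let $G$ be a finite connected graph. Then $$\max\{\sigma^{\times}_{E}(G),\sigma^{\square}_{E}(G)\}\le\sigma^{\boxtimes}_{E}(G)\le \max\{\sigma^{\times}_{E}(G),\sigma^{\square}_{E}(G)\}+1.$$
   Context: All graphs are finite, simple, nonempty and connected; $\mathbb{N}_l=\{1,\dots,l\}$ (with $\mathbb{N}_0=\emptyset$), and $d_G$ is the usual shortest-path distance. Let $G$ be a graph and $l\in\mathbb{N}$, $l\ge 1$. A surjective function $f:\mathbb{N}_l\to V(G)$ is an $l$-track on $G$ if $f(i)f(i+1)\in E(G)$ for every $i\in\mathbb{N}_{l-1}$; it is a lazy $l$-track if for every $i\in\mathbb{N}_{l-1}$ either $f(i)f(i+1)\in E(G)$ or $f(i)=f(i+1)$. An $l$-sweep (respectively lazy $l$-sweep) is an $l$-track (respectively lazy $l$-track) $f$ such that for every edge $uv\in E(G)$ there is $i\in\mathbb{N}_{l-1}$ with $f(i)f(i+1)=uv$ (as unordered pairs). Two lazy $l$-sweeps $f,g$ are opposite if for all $i\in\mathbb{N}_{l-1}$: $f(i)f(i+1)\in E(G)\iff g(i)=g(i+1)$. For lazy $l$-sweeps $f,g$ put $m_G(f,g)=\min\{d_G(f(i),g(i)) : i\in\mathbb{N}_l\}$. The strong edge span $\sigma^{\boxtimes}_E(G)$, the direct edge span $\sigma^{\times}_E(G)$ and the Cartesian edge span $\sigma^{\square}_E(G)$ are the maximum of $m_G(f,g)$ over all $l$ and all pairs $(f,g)$ of, respectively, lazy $l$-sweeps, $l$-sweeps, opposite lazy $l$-sweeps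 on $G$. *)

theory Defs
  imports "Graph_Theory.Graph_Theory"
begin

text \<open>
  A finite simple graph is a \<open>pair_graph\<close>: a finite loop-free digraph whose arc relation
  \<open>parcs G\<close> is symmetric, so that \<open>uv\<close> is an edge iff \<open>(u, v) \<in> parcs G\<close>. Nonemptiness of
  the vertex set is part of \<open>Digraph_Component.connected\<close>.
\<close>

text \<open>Only meaningful when \<open>v\<close> is reachable from \<open>u\<close>; cf. \<open>gdist_eq_mu\<close> below.\<close>

definition gdist :: "'a pair_pre_digraph \<Rightarrow> 'a \<Rightarrow> 'a \<Rightarrow> nat" where
  "gdist G u v = (LEAST n. \<exists>p. pre_digraph.apath (with_proj G) u p v \<and> length p = n)"

text \<open>
  A function on \<open>{1..l}\<close> is represented by a total function on \<open>nat\<close>, whose values outside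
  \<open>{1..l}\<close> are never used. For \<open>l = 1\<close> the set \<open>{1..l - 1}\<close> is empty.
\<close>

definition track :: "'a pair_pre_digraph \<Rightarrow> nat \<Rightarrow> (nat \<Rightarrow> 'a) \<Rightarrow> bool" where
  "track G l f \<longleftrightarrow> l \<ge> 1 \<and> f ` {1..l} = pverts G \<and>
     (\<forall>i\<in>{1..l - 1}. (f i, f (i + 1)) \<in> parcs G)"

definition lazy_track :: "'a pair_pre_digraph \<Rightarrow> nat \<Rightarrow> (nat \<Rightarrow> 'a) \<Rightarrow> bool" where
  "lazy_track G l f \<longleftrightarrow> l \<ge> 1 \<and> f ` {1..l} = pverts G \<and>
     (\<forall>i\<in>{1..l - 1}. (f i, f (i + 1)) \<in> parcs G \<or> f i = f (i + 1))"

definition covers_edges :: "'a pair_pre_digraph \<Rightarrow> nat \<Rightarrow> (nat \<Rightarrow> 'a) \<Rightarrow> bool" where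
  "covers_edges G l f \<longleftrightarrow>
     (\<forall>u v. (u, v) \<in> parcs G \<longrightarrow> (\<exists>i\<in>{1..l - 1}. {f i, f (i + 1)} = {u, v}))"

definition sweep :: "'a pair_pre_digraph \<Rightarrow> nat \<Rightarrow> (nat \<Rightarrow> 'a) \<Rightarrow> bool" where
  "sweep G l f \<longleftrightarrow> track G l f \<and> covers_edges G l f"

definition lazy_sweep :: "'a pair_pre_digraph \<Rightarrow> nat \<Rightarrow> (nat \<Rightarrow> 'a) \<Rightarrow> bool" where
  "lazy_sweep G l f \<longleftrightarrow> lazy_track G l f \<and> covers_edges G l f"

definition opposite :: "'a pair_pre_digraph \<Rightarrow> nat \<Rightarrow> (nat \<Rightarrow> 'a) \<Rightarrow> (nat \<Rightarrow> 'a) \<Rightarrow> bool" where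
  "opposite G l f g \<longleftrightarrow>
     (\<forall>i\<in>{1..l - 1}. (f i, f (i + 1)) \<in> parcs G \<longleftrightarrow> g i = g (i + 1))"

definition min_dist :: "'a pair_pre_digraph \<Rightarrow> nat \<Rightarrow> (nat \<Rightarrow> 'a) \<Rightarrow> (nat \<Rightarrow> 'a) \<Rightarrow> nat" where
  "min_dist G l f g = Min {gdist G (f i) (g i) | i. i \<in> {1..l}}"

text \<open>
  On a finite connected graph the three sets below are finite (distances take finitely many
  values) and nonempty, so \<open>Max\<close> is the genuine maximum.
\<close>

definition strong_edge_span :: "'a pair_pre_digraph \<Rightarrow> nat" where
  "strong_edge_span G = Max {min_dist G l f g | l f g. lazy_sweep G l f \<and> lazy_sweep G l g}"

definition direct_edge_span :: "'a pair_pre_digraph \<Rightarrow> nat" where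
  "direct_edge_span G = Max {min_dist G l f g | l f g. sweep G l f \<and> sweep G l g}"

definition cartesian_edge_span :: "'a pair_pre_digraph \<Rightarrow> nat" where
  "cartesian_edge_span G =
     Max {min_dist G l f g | l f g. lazy_sweep G l f \<and> lazy_sweep G l g \<and> opposite G l f g}"

text \<open>\<open>gdist\<close> is the library's shortest-path distance with unit weights.\<close>

lemma (in wf_digraph) awalk_cost_one: "awalk_cost (\<lambda>_. 1) p = real (length p)"
  by (induction p) auto

lemma gdist_eq_mu:
  assumes "pair_graph G" and "reachable (with_proj G) u v"
  shows "wf_digraph.\<mu> (with_proj G) (\<lambda>_. 1) u v = ereal (real (gdist G u v))"
proof -
  interpret W: fin_digraph "with_proj G"
    using assms(1) by (meson digraph.axioms(1) graph.axioms(1) pair_graph.pair_graphD_graph)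
  obtain p where p: "W.apath u p v"
      and mu: "W.\<mu> (\<lambda>_. 1) u v = ereal (W.awalk_cost (\<lambda>_. 1) p)"
    using W.min_cost_awalk[OF assms(2), of "\<lambda>_. 1"] by auto
  have "length p \<le> length q" if "W.apath u q v" for q
    using W.min_cost_le_walk_cost[of u q v "\<lambda>_. 1"] that mu
    by (simp add: W.awalk_cost_one W.apath_def)
  then have "gdist G u v = length p"
    unfolding gdist_def using p by (intro Least_equality) auto
  then show ?thesis
    using mu by (simp add: W.awalk_cost_one)
qed

end

theory Submission
  imports Defs
begin

text \<open>
  Sweeps are lazy sweeps, and opposite lazy sweeps are in particular lazy sweeps, so the lower
  bound is a comparison of maxima over nested sets; what has to be
  supplied is that the smaller sets are nonempty and the largest one is finite.

  The upper bound comes from the sharper inequality that the strong edge span exceeds the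
  Cartesian edge span by at most one. Take two lazy sweeps at mutual distance \<open>s\<close> or more and
  think of two players moving at the same time. Slow the game down: when both players want to move,
  the first one moves while the second one waits, and then the second one moves; when neither player
  wants to move, the step is deleted. Now exactly one player moves in every step, so the lazy sweeps
  are opposite. Every player still traverses the same vertices and edges. The only positions added
  are of the form \<open>(x', y)\<close>, between \<open>(x, y)\<close> and \<open>(x', y')\<close>; since \<open>y\<close> and \<open>y'\<close> are
  adjacent and the distance from \<open>x'\<close> to \<open>y'\<close> is at least \<open>s\<close>, the distance from \<open>x'\<close>
  to \<open>y\<close> is at least \<open>s - 1\<close>.

  The slowed-down game is the function \<open>alternate\<close> on lists of positions, and
  \<open>opposite_lazy_sweeps_of_lazy_sweeps\<close> records its effect on lazy sweeps. Applied to two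
  equal sweeps it also shows that opposite lazy sweeps exist. A sweep exists because finitely many
  walks can be joined to one another in a connected graph.
\<close>

section \<open>Consecutive pairs in lists\<close>

lemma set_vwalk_arcs_map_upt:
  "set (vwalk_arcs (map h [1..<Suc l])) = (\<lambda>i. (h i, h (i + 1))) ` {1..l - 1}"
proof (induction l)
  case (Suc l)
  show ?case
  proof (cases l)
    case (Suc k)
    have "set (vwalk_arcs (map h [1..<Suc l] @ [h (Suc l)]))
        = insert (h l, h (Suc l)) (set (vwalk_arcs (map h [1..<Suc l])))"
      using Suc by (subst set_vwalk_arcs_snoc) auto
    also have "\<dots> = (\<lambda>i. (h i, h (i + 1))) ` insert l {1..l - 1}"
      unfolding Suc.IH by simp
    also have "insert l {1..l - 1} = {1..Suc l - 1}"
      using Suc by auto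
    finally show ?thesis by simp
  qed simp
qed simp

text \<open>
  All conditions are about the set of vertices and the set of consecutive pairs, so that times and
  indices disappear from the argument.
\<close>

definition lazy_sweep_list :: "'a pair_pre_digraph \<Rightarrow> 'a list \<Rightarrow> bool" where
  "lazy_sweep_list G p \<longleftrightarrow> p \<noteq> [] \<and> set p = pverts G \<and>
     set (vwalk_arcs p) \<subseteq> parcs G \<union> Id \<and>
     parcs G \<subseteq> set (vwalk_arcs p) \<union> (set (vwalk_arcs p))\<inverse>"

lemma covers_edges_iff:
  "covers_edges G l f \<longleftrightarrow> parcs G \<subseteq> set (vwalk_arcs (map f [1..<Suc l]))
     \<union> (set (vwalk_arcs (map f [1..<Suc l])))\<inverse>"
  unfolding covers_edges_def set_vwalk_arcs_map_upt
  by (auto simp: doubleton_eq_iff subset_iff image_iff Bex_def) metis+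

lemma set_map_upt_Suc: "set (map h [1..<Suc l]) = h ` {1..l}"
  by (simp add: atLeastLessThanSuc_atLeastAtMost del: upt_Suc)

lemma lazy_sweep_iff_list: "lazy_sweep G l f \<longleftrightarrow> lazy_sweep_list G (map f [1..<Suc l])"
proof -
  have "(\<forall>i\<in>{1..l - 1}. (f i, f (i + 1)) \<in> parcs G \<or> f i = f (i + 1)) \<longleftrightarrow>
      set (vwalk_arcs (map f [1..<Suc l])) \<subseteq> parcs G \<union> Id"
    unfolding set_vwalk_arcs_map_upt by auto
  moreover have "map f [1..<Suc l] \<noteq> [] \<longleftrightarrow> l \<ge> 1"
    by auto
  ultimately show ?thesis
    unfolding lazy_sweep_def lazy_track_def lazy_sweep_list_def covers_edges_iff set_map_upt_Suc
    by blast
qed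

lemma sweep_iff_lazy_sweep:
  "sweep G l f \<longleftrightarrow> lazy_sweep G l f \<and> set (vwalk_arcs (map f [1..<Suc l])) \<subseteq> parcs G"
  unfolding sweep_def lazy_sweep_def track_def lazy_track_def set_vwalk_arcs_map_upt by auto

lemma list_as_map_upt: "xs = map (\<lambda>i. xs ! (i - 1)) [1..<Suc (length xs)]"
  by (rule nth_equalityI) (auto simp del: upt_Suc)

section \<open>Letting two players move in turn\<close>

fun alternate :: "('a \<times> 'b) list \<Rightarrow> ('a \<times> 'b) list" where
  "alternate (a # b # xs) =
     (if a = b then alternate (b # xs)
      else if fst a = fst b \<or> snd a = snd b then a # alternate (b # xs)
      else a # (fst b, snd a) # alternate (b # xs))"
| "alternate xs = xs"

lemma alternate_eq_Nil_iff [simp]: "alternate xs = [] \<longleftrightarrow> xs = []"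
  by (induction xs rule: alternate.induct) auto

lemma hd_alternate [simp]: "hd (alternate xs) = hd xs"
  by (induction xs rule: alternate.induct) auto

lemma fst_set_alternate: "fst ` set (alternate xs) = fst ` set xs"
  by (induction xs rule: alternate.induct) (auto split: if_splits)

lemma snd_set_alternate: "snd ` set (alternate xs) = snd ` set xs"
  by (induction xs rule: alternate.induct) (auto split: if_splits)

text \<open>
  Slowing down the game adds and removes only steps in which the player under consideration
  stands still, hence the identity relation on both sides.
\<close>

lemma fst_vwalk_arcs_alternate:
  "set (vwalk_arcs (map fst (alternate xs))) \<union> Id = set (vwalk_arcs (map fst xs)) \<union> Id"
  by (induction xs rule: alternate.induct) (auto simp: hd_map)

lemma snd_vwalk_arcs_alternate:
  "set (vwalk_arcs (map snd (alternate xs))) \<union> Id = set (vwalk_arcs (map snd xs)) \<union> Id"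
  by (induction xs rule: alternate.induct) (auto simp: hd_map)

lemma exactly_one_moves_alternate:
  "(a, b) \<in> set (vwalk_arcs (alternate xs)) \<Longrightarrow> fst a = fst b \<longleftrightarrow> snd a \<noteq> snd b"
  by (induction xs rule: alternate.induct) (auto split: if_splits simp: prod_eq_iff)

lemma set_alternate_cases:
  assumes "x \<in> set (alternate xs)"
  obtains (old) "x \<in> set xs"
    | (between) a b where "(a, b) \<in> set (vwalk_arcs xs)" "x = (fst b, snd a)"
  using assms by (induction xs rule: alternate.induct) (auto split: if_splits)

section \<open>From lazy sweeps to opposite lazy sweeps\<close>

text \<open>
  Since the graph has no loops, pauses neither violate nor help to satisfy a condition on lazy
  sweeps; hence consecutive pairs matter only up to the identity relation.
\<close>

lemma (in pair_graph) lazy_sweep_list_cong: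
  assumes "lazy_sweep_list G p" and "set q = set p"
    and "set (vwalk_arcs q) \<union> Id = set (vwalk_arcs p) \<union> Id"
  shows "lazy_sweep_list G q"
proof -
  have "q \<noteq> []"
    using assms(1,2) by (auto simp: lazy_sweep_list_def)
  moreover have "set (vwalk_arcs q) \<subseteq> parcs G \<union> Id"
    using assms(1,3) unfolding lazy_sweep_list_def by blast
  moreover have "parcs G \<subseteq> set (vwalk_arcs q) \<union> (set (vwalk_arcs q))\<inverse>"
  proof
    fix e assume e: "e \<in> parcs G"
    obtain u v where uv: "e = (u, v)" by (cases e)
    have "u \<noteq> v" using e no_loops' uv by auto
    moreover have "(u, v) \<in> set (vwalk_arcs p) \<or> (v, u) \<in> set (vwalk_arcs p)"
      using assms(1) e uv unfolding lazy_sweep_list_def by blast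
    ultimately show "e \<in> set (vwalk_arcs q) \<union> (set (vwalk_arcs q))\<inverse>"
      using assms(3) uv by blast
  qed
  ultimately show ?thesis
    using assms(1,2) unfolding lazy_sweep_list_def by simp
qed

lemma (in pair_graph) gdist_step:
  assumes "(u, v) \<in> parcs G" and "reachable (with_proj G) x u"
  shows "gdist G x v \<le> gdist G x u + 1"
proof -
  have "reachable (with_proj G) x v"
    using assms by (auto intro: reachable_adj_trans)
  moreover have "\<mu> (\<lambda>_. 1) x v \<le> \<mu> (\<lambda>_. 1) x u + 1"
    using pos_cost_mu_triangle[of "\<lambda>_. 1" "(u, v)" u v x] assms(1)
    by (simp add: arc_to_ends_def one_ereal_def)
  ultimately show ?thesis
    using gdist_eq_mu[OF pair_graph] assms(2) by (simp add: one_ereal_def)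
qed

lemma le_min_dist_iff:
  assumes "l \<ge> 1"
  shows "s \<le> min_dist G l f g \<longleftrightarrow> (\<forall>i\<in>{1..l}. s \<le> gdist G (f i) (g i))"
proof -
  have "{gdist G (f i) (g i) | i. i \<in> {1..l}} = (\<lambda>i. gdist G (f i) (g i)) ` {1..l}"
    by auto
  then show ?thesis
    using assms by (simp add: min_dist_def)
qed

lemma lazy_sweep_ge_1: "lazy_sweep G l f \<Longrightarrow> l \<ge> 1"
  by (simp add: lazy_sweep_def lazy_track_def)

lemma lazy_sweep_in_verts: "lazy_sweep G l f \<Longrightarrow> i \<in> {1..l} \<Longrightarrow> f i \<in> pverts G"
  by (auto simp: lazy_sweep_def lazy_track_def)

text \<open>
  Playing in turn costs at most one unit of distance, because each additional position is one move
  of the second player away from an original position.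
\<close>

lemma (in pair_graph) opposite_lazy_sweeps_of_lazy_sweeps:
  assumes conn: "strongly_connected (with_proj G)"
    and f: "lazy_sweep G l f" and g: "lazy_sweep G l g"
  obtains m f' g' where "lazy_sweep G m f'" "lazy_sweep G m g'" "opposite G m f' g'"
    "min_dist G l f g \<le> min_dist G m f' g' + 1"
proof -
  define xs where "xs = map (\<lambda>i. (f i, g i)) [1..<Suc l]"
  define ys where "ys = alternate xs"
  define m where "m = length ys"
  define f' where "f' i = fst (ys ! (i - 1))" for i
  define g' where "g' i = snd (ys ! (i - 1))" for i
  have ys_eq: "ys = map (\<lambda>i. (f' i, g' i)) [1..<Suc m]"
    using list_as_map_upt[of ys] by (simp add: f'_def g'_def m_def del: upt_Suc)
  have fst_xs: "map fst xs = map f [1..<Suc l]" and snd_xs: "map snd xs = map g [1..<Suc l]"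
    by (simp_all add: xs_def del: upt_Suc)
  have fst_ys: "map fst ys = map f' [1..<Suc m]" and snd_ys: "map snd ys = map g' [1..<Suc m]"
    by (subst ys_eq, simp del: upt_Suc)+
  have f': "lazy_sweep G m f'"
    using f unfolding lazy_sweep_iff_list fst_xs[symmetric] fst_ys[symmetric]
    by (rule lazy_sweep_list_cong)
      (simp_all add: ys_def fst_set_alternate fst_vwalk_arcs_alternate)
  have g': "lazy_sweep G m g'"
    using g unfolding lazy_sweep_iff_list snd_xs[symmetric] snd_ys[symmetric]
    by (rule lazy_sweep_list_cong)
      (simp_all add: ys_def snd_set_alternate snd_vwalk_arcs_alternate)
  have "opposite G m f' g'"
    unfolding opposite_def
  proof
    fix i assume i: "i \<in> {1..m - 1}"
    have "((f' i, g' i), (f' (i + 1), g' (i + 1))) \<in> set (vwalk_arcs ys)"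
      by (subst ys_eq, subst set_vwalk_arcs_map_upt) (use i in auto)
    then have "f' i = f' (i + 1) \<longleftrightarrow> g' i \<noteq> g' (i + 1)"
      using exactly_one_moves_alternate unfolding ys_def by fastforce
    moreover have "(f' i, f' (i + 1)) \<in> parcs G \<or> f' i = f' (i + 1)"
      using f' i by (simp add: lazy_sweep_def lazy_track_def)
    ultimately show "(f' i, f' (i + 1)) \<in> parcs G \<longleftrightarrow> g' i = g' (i + 1)"
      using no_loops' by metis
  qed
  moreover have "min_dist G l f g \<le> min_dist G m f' g' + 1"
  proof -
    define s where "s = min_dist G l f g"
    have s: "s \<le> gdist G (f i) (g i)" if "i \<in> {1..l}" for i
      using le_min_dist_iff[OF lazy_sweep_ge_1[OF f]] s_def that by blast
    have dist_ys: "s \<le> gdist G (fst x) (snd x) + 1" if "x \<in> set ys" for x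
      using that unfolding ys_def
    proof (cases rule: set_alternate_cases)
      case old
      then show ?thesis
        using s by (force simp: xs_def simp del: upt_Suc)
    next
      case (between a b)
      then obtain i where i: "i \<in> {1..l - 1}" and x: "x = (f (i + 1), g i)"
        unfolding xs_def set_vwalk_arcs_map_upt by auto
      have i': "i \<in> {1..l}" "i + 1 \<in> {1..l}"
        using i by auto
      have "reachable (with_proj G) (f (i + 1)) (g i)"
        using conn lazy_sweep_in_verts[OF f i'(2)] lazy_sweep_in_verts[OF g i'(1)]
        by (auto simp: strongly_connected_def)
      moreover have "(g i, g (i + 1)) \<in> parcs G \<or> g i = g (i + 1)"
        using g i by (simp add: lazy_sweep_def lazy_track_def)
      ultimately have "gdist G (f (i + 1)) (g (i + 1)) \<le> gdist G (f (i + 1)) (g i) + 1"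
        using gdist_step by auto
      then show ?thesis
        using s[OF i'(2)] x by simp
    qed
    have "s - 1 \<le> gdist G (f' i) (g' i)" if "i \<in> {1..m}" for i
    proof -
      have "(f' i, g' i) \<in> set ys"
        by (subst ys_eq, subst set_map_upt_Suc) (use that in blast)
      then show ?thesis
        using dist_ys by force
    qed
    then have "s - 1 \<le> min_dist G m f' g'"
      using le_min_dist_iff[OF lazy_sweep_ge_1[OF f']] by blast
    then show ?thesis
      unfolding s_def by linarith
  qed
  ultimately show thesis
    using f' g' that by blast
qed

section \<open>Existence of sweeps\<close>

text \<open>
  Connectedness provides a walk from the end of the walk built so far to the tail of the next arc.
\<close>

lemma (in pair_graph) vwalk_through_arcs:
  assumes conn: "strongly_connected (with_proj G)"
    and "finite S" and "S \<subseteq> parcs G"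
  shows "\<exists>p. vwalk p (with_proj G) \<and> S \<subseteq> set (vwalk_arcs p)"
  using assms(2,3)
proof (induction S)
  case empty
  obtain v where "v \<in> pverts G"
    using conn by (auto simp: strongly_connected_def)
  then have "vwalk [v] (with_proj G)"
    by (auto simp: vwalk_def)
  then show ?case by (intro exI[of _ "[v]"]) simp
next
  case (insert e S)
  obtain u v where e: "e = (u, v)" by (cases e)
  from insert obtain p where p: "vwalk p (with_proj G)" "S \<subseteq> set (vwalk_arcs p)"
    by auto
  have uv: "(u, v) \<in> parcs G" "u \<in> pverts G" "v \<in> pverts G"
    using insert.prems e by (auto dest: wellformed')
  have "last p \<in> pverts G"
    using p(1) by (auto simp: vwalk_def)
  then have "reachable (with_proj G) (last p) u"
    using conn uv by (auto simp: strongly_connected_def)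
  then obtain q where q: "vwalk q (with_proj G)" "hd q = last p" "last q = u"
    by (auto simp: reachable_vwalk_conv)
  have ne: "p \<noteq> []" "q \<noteq> []"
    using p(1) q(1) by (auto simp: vwalk_def)
  have "vwalk [u, v] (with_proj G)"
    using uv by (auto simp: vwalk_def)
  then have "vwalk (p \<oplus> (q \<oplus> [u, v])) (with_proj G)"
    using p q ne by (intro vwalk_joinI_vwalk') (auto simp: vwalk_join_hd')
  moreover have "vwalk_arcs (p \<oplus> (q \<oplus> [u, v])) = vwalk_arcs p @ vwalk_arcs q @ [(u, v)]"
    using q ne by (simp add: vwalk_join_arcs vwalk_join_hd')
  ultimately show ?case
    using p(2) e by (intro exI[of _ "p \<oplus> (q \<oplus> [u, v])"]) auto
qed

lemma (in pair_graph) sweep_exists: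
  assumes conn: "strongly_connected (with_proj G)"
  obtains l f where "sweep G l f"
proof -
  obtain p where p: "vwalk p (with_proj G)" and arcs: "parcs G \<subseteq> set (vwalk_arcs p)"
    using vwalk_through_arcs[OF conn pair_finite_arcs] by auto
  have ne: "p \<noteq> []" and vp: "set p \<subseteq> pverts G" and ap: "set (vwalk_arcs p) \<subseteq> parcs G"
    using p by (auto simp: vwalk_def)
  have "pverts G \<subseteq> set p"
  proof
    fix x assume x: "x \<in> pverts G"
    have "hd p \<in> pverts G"
      using ne vp hd_in_set by blast
    then have "reachable (with_proj G) x (hd p)"
      using conn x by (auto simp: strongly_connected_def)
    then show "x \<in> set p"
    proof (cases rule: converse_reachable_cases)
      case base
      then show ?thesis using ne by simp
    next
      \<comment> \<open>An arc that leaves \<open>x\<close> is traversed, so \<open>x\<close> is visited.\<close>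
      case (step w)
      then show ?thesis
        using arcs by (auto elim: in_set_vwalk_arcsE)
    qed
  qed
  then have "lazy_sweep_list G p"
    using ne vp ap arcs unfolding lazy_sweep_list_def by blast
  then have "sweep G (length p) (\<lambda>i. p ! (i - 1))"
    using ap list_as_map_upt[of p] unfolding sweep_iff_lazy_sweep lazy_sweep_iff_list by simp
  then show thesis by (rule that)
qed

section \<open>Comparison of the spans\<close>

text \<open>
  There may be infinitely many pairs of lazy sweeps, but their minimal distances are distances between
  two of the finitely many vertices.
\<close>

lemma (in pair_graph) finite_min_dists:
  "finite {min_dist G l f g | l f g. lazy_sweep G l f \<and> lazy_sweep G l g}"
proof (rule finite_subset)
  show "finite ((\<lambda>(u, v). gdist G u v) ` (pverts G \<times> pverts G))"
    using pair_finite_verts by simp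
  show "{min_dist G l f g | l f g. lazy_sweep G l f \<and> lazy_sweep G l g}
      \<subseteq> (\<lambda>(u, v). gdist G u v) ` (pverts G \<times> pverts G)"
  proof clarify
    fix l f g assume fg: "lazy_sweep G l f" "lazy_sweep G l g"
    have "min_dist G l f g \<in> (\<lambda>i. gdist G (f i) (g i)) ` {1..l}"
      unfolding min_dist_def Setcompr_eq_image
      using lazy_sweep_ge_1[OF fg(1)] by (intro Min_in) auto
    then obtain i where "i \<in> {1..l}" "min_dist G l f g = gdist G (f i) (g i)"
      by auto
    then show "min_dist G l f g \<in> (\<lambda>(u, v). gdist G u v) ` (pverts G \<times> pverts G)"
      using lazy_sweep_in_verts fg by fastforce
  qed
qed

theorem theorem5p10:
  fixes G :: "'a pair_pre_digraph"
  assumes "pair_graph G" and "Digraph_Component.connected (with_proj G)"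
  shows "max (direct_edge_span G) (cartesian_edge_span G) \<le> strong_edge_span G \<and>
         strong_edge_span G \<le> max (direct_edge_span G) (cartesian_edge_span G) + 1"
proof -
  interpret pair_graph G by fact
  have conn: "strongly_connected (with_proj G)"
    using symmetric_connected_imp_strongly_connected[OF sym_arcs assms(2)] .
  let ?S = "{min_dist G l f g | l f g. lazy_sweep G l f \<and> lazy_sweep G l g}"
  let ?D = "{min_dist G l f g | l f g. sweep G l f \<and> sweep G l g}"
  let ?C = "{min_dist G l f g | l f g. lazy_sweep G l f \<and> lazy_sweep G l g \<and> opposite G l f g}"
  obtain l0 f0 where f0: "sweep G l0 f0"
    using sweep_exists[OF conn] .
  then have lazy_f0: "lazy_sweep G l0 f0"
    by (simp add: sweep_iff_lazy_sweep)
  have "?D \<subseteq> ?S"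
    unfolding sweep_iff_lazy_sweep by blast
  moreover have "?D \<noteq> {}"
    using f0 by blast
  ultimately have direct: "direct_edge_span G \<le> strong_edge_span G"
    unfolding direct_edge_span_def strong_edge_span_def
    using finite_min_dists by (intro Max_mono)
  have C: "?C \<subseteq> ?S"
    by blast
  obtain m0 f1 g1
    where "lazy_sweep G m0 f1" "lazy_sweep G m0 g1" "opposite G m0 f1 g1"
    using opposite_lazy_sweeps_of_lazy_sweeps[OF conn lazy_f0 lazy_f0] .
  then have "?C \<noteq> {}"
    by blast
  with C have cart: "cartesian_edge_span G \<le> strong_edge_span G"
    unfolding cartesian_edge_span_def strong_edge_span_def
    using finite_min_dists by (intro Max_mono)
  have "strong_edge_span G \<le> cartesian_edge_span G + 1"
  proof -
    have "strong_edge_span G \<in> ?S"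
      unfolding strong_edge_span_def
    proof (rule Max_in[OF finite_min_dists])
      show "?S \<noteq> {}"
        using lazy_f0 by blast
    qed
    then obtain l f g where fg: "lazy_sweep G l f" "lazy_sweep G l g"
      and s: "strong_edge_span G = min_dist G l f g"
      by blast
    obtain m f' g' where fg': "lazy_sweep G m f'" "lazy_sweep G m g'" "opposite G m f' g'"
      and le: "min_dist G l f g \<le> min_dist G m f' g' + 1"
      using opposite_lazy_sweeps_of_lazy_sweeps[OF conn fg] .
    have "min_dist G m f' g' \<le> cartesian_edge_span G"
      unfolding cartesian_edge_span_def
    proof (rule Max_ge[OF finite_subset[OF C finite_min_dists]])
      show "min_dist G m f' g' \<in> ?C"
        using fg' by blast
    qed
    then show ?thesis
      using s le by linarith
  qed
  then show ?thesis
    using direct cart by linarith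
qed

end
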